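(* Let $\Gamma=(G,\sigma)$ be a signed graph such that every induced strongly positive cycle and every induced weakly negative cycle of $\Gamma$ is a triangle. Suppose that $\Gamma$ contains none of the graphs (a), (b), (c) described in the context as a subgraph. Then the C.C Algorithm gives a $2$-approximation for correlation clustering of $\Gamma$: if $D(Sol(\Gamma))$ is the number of disagreements of the clustering obtained by the C.C Algorithm and $D(Opt(\Gamma))$ is the minimum number of disagreements over all clusterings of $\Gamma$, then $D(Sol(\Gamma))\le 2\,D(Opt(\Gamma))$.
   Context: All graphs are finite, simple and undirected. A signed graph $\Gamma=(G,\sigma)$ is a graph $G=(V,E)$ together with a sign function $\sigma:E\to\{-1,+1\}$; edges of sign $+1$ are positive and edges of sign $-1$ are negative. A clustering is a partition of $V$ into clusters (any number of them). A disagreement of a clustering is a negative edge with both endpoints in the same cluster or a positive edge with endpoints in different clusters. A cycle is strongly positive if all its edges are positive, and weakly negative if it contains exactly one negative edge. An induced cycle is a cycle with no chord (positive or negative). For disjoint $V_1,V_2\subseteq V$, $D^{+}(V_1,V_2)$ and $D^{-}(V_1,V_2)$ denote the numbers of positive and of negative edges of $\Gamma$ between $V_1$ and $V_2$, respectively. Forbidden subgraphs (subgraphs are not required to be induced; signs must agree). (a) The graph on vertices $v_1,v_2,v_3,v_4$ with negative edge $v_1v_2$ and positive edges $v_1v_3,v_2v_3,v_1v_4,v_2v_4$ (two weakly negative triangles sharing their negative edge). (b) The graph on vertices $v_1,\dots,v_5$ with negative edge $v_1v_2$ and positive edges $v_1v_3,v_2v_3,v_1v_4,v_3v_4,v_2v_5,v_3v_5$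 (two strongly positive triangles $v_1v_3v_4$ and $v_2v_3v_5$ sharing the vertex $v_3$, together with the negative edge $v_1v_2$). (c) Any graph consisting of three distinct weakly negative triangles with a common positive edge: a positive edge $xy$ and three distinct vertices $z_1,z_2,z_3$, each $z_i$ adjacent to both $x$ and $y$, with exactly one of the edges $xz_i,yz_i$ negative for each $i$ (all choices of which one is negative are forbidden). C.C Algorithm, with input a signed graph $\Gamma$: (1) Put each isolated vertex, and each vertex all of whose incident edges are negative, in its own new cluster. Remove these vertices from $\Gamma$. (2) In the remaining graph, put the vertices of each strongly positive triangle in a new cluster; if some strongly positive triangles are connected to each other by a common edge or a common vertex, put all of their vertices in one new cluster. Remove all these vertices. (3) Find a maximum matching among the positive edges of the remaining graph, and put the two endpoints of each matching edge in a new cluster. Remove these vertices. (4) Put each remaining vertex in its own new cluster, and restore all edges of the initial graph $\Gamma$, between or inside the clusters. (5) Ignoring the clusters created in step (1): if there are two clusters $V_1,V_2$ with $D^{-}(V_1,V_2)=0$ and $D^{+}(V_1,V_2)\ge 1$, then, among all such pairs, merge two clusters with the largest positive degree $D^{+}(V_1,V_2)$; then recompute the degrees for the new clusters. (6) Repeat step (5) until there is no pair of clusters with zero negative degree and nonzero positive degree. The output is the resulting clustering $Sol(\Gamma)$. *)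

theory Defs
  imports Main "HOL-Library.Disjoint_Sets"
begin

record 'a sgraph =
  vertices :: "'a set"
  edges :: "'a set set"
  sigma :: "'a set \<Rightarrow> int"

text \<open>An edge is a two-element set of vertices; the values of \<open>sigma\<close> outside
  \<open>edges\<close> are irrelevant.\<close>

definition signed_graph :: "'a sgraph \<Rightarrow> bool" where
  "signed_graph \<Gamma> \<longleftrightarrow>
     finite (vertices \<Gamma>) \<and>
     (\<forall>e\<in>edges \<Gamma>. e \<subseteq> vertices \<Gamma> \<and> card e = 2) \<and>
     (\<forall>e\<in>edges \<Gamma>. sigma \<Gamma> e = 1 \<or> sigma \<Gamma> e = -1)"

definition pos_edges :: "'a sgraph \<Rightarrow> 'a set set" where
  "pos_edges \<Gamma> = {e \<in> edges \<Gamma>. sigma \<Gamma> e = 1}"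

definition neg_edges :: "'a sgraph \<Rightarrow> 'a set set" where
  "neg_edges \<Gamma> = {e \<in> edges \<Gamma>. sigma \<Gamma> e = -1}"

definition remove_vertices :: "'a sgraph \<Rightarrow> 'a set \<Rightarrow> 'a sgraph" where
  "remove_vertices \<Gamma> S =
     \<Gamma>\<lparr>vertices := vertices \<Gamma> - S, edges := {e \<in> edges \<Gamma>. e \<inter> S = {}}\<rparr>"


subsection \<open>Clusterings and disagreements\<close>

definition clustering :: "'a sgraph \<Rightarrow> 'a set set \<Rightarrow> bool" where
  "clustering \<Gamma> C \<longleftrightarrow> partition_on (vertices \<Gamma>) C"

definition disagreements :: "'a sgraph \<Rightarrow> 'a set set \<Rightarrow> 'a set set" where
  "disagreements \<Gamma> C =
     {{x, y} | x y. {x, y} \<in> neg_edges \<Gamma> \<and> (\<exists>K\<in>C. x \<in> K \<and> y \<in> K)} \<union>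
     {{x, y} | x y. {x, y} \<in> pos_edges \<Gamma> \<and> (\<exists>K\<in>C. \<exists>L\<in>C. K \<noteq> L \<and> x \<in> K \<and> y \<in> L)}"

definition num_disagreements :: "'a sgraph \<Rightarrow> 'a set set \<Rightarrow> nat" where
  "num_disagreements \<Gamma> C = card (disagreements \<Gamma> C)"

definition opt_disagreements :: "'a sgraph \<Rightarrow> nat" where
  "opt_disagreements \<Gamma> = Min {num_disagreements \<Gamma> C | C. clustering \<Gamma> C}"


subsection \<open>Cycles\<close>

text \<open>A cycle is given by the list of its vertices in cyclic order.\<close>

definition cycle_edges :: "'a list \<Rightarrow> 'a set set" where
  "cycle_edges vs = {{vs ! i, vs ! (Suc i mod length vs)} | i. i < length vs}"

definition cycle :: "'a sgraph \<Rightarrow> 'a list \<Rightarrow> bool" where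
  "cycle \<Gamma> vs \<longleftrightarrow>
     length vs \<ge> 3 \<and> distinct vs \<and> set vs \<subseteq> vertices \<Gamma> \<and> cycle_edges vs \<subseteq> edges \<Gamma>"

definition induced_cycle :: "'a sgraph \<Rightarrow> 'a list \<Rightarrow> bool" where
  "induced_cycle \<Gamma> vs \<longleftrightarrow>
     cycle \<Gamma> vs \<and> (\<forall>e\<in>edges \<Gamma>. e \<subseteq> set vs \<longrightarrow> e \<in> cycle_edges vs)"

definition strongly_positive :: "'a sgraph \<Rightarrow> 'a list \<Rightarrow> bool" where
  "strongly_positive \<Gamma> vs \<longleftrightarrow> cycle_edges vs \<subseteq> pos_edges \<Gamma>"

definition weakly_negative :: "'a sgraph \<Rightarrow> 'a list \<Rightarrow> bool" where
  "weakly_negative \<Gamma> vs \<longleftrightarrow> card (cycle_edges vs \<inter> neg_edges \<Gamma>) = 1"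


subsection \<open>Forbidden subgraphs\<close>

definition contains_a :: "'a sgraph \<Rightarrow> bool" where
  "contains_a \<Gamma> \<longleftrightarrow> (\<exists>v1 v2 v3 v4. distinct [v1, v2, v3, v4] \<and>
     {v1, v2} \<in> neg_edges \<Gamma> \<and>
     {{v1, v3}, {v2, v3}, {v1, v4}, {v2, v4}} \<subseteq> pos_edges \<Gamma>)"

definition contains_b :: "'a sgraph \<Rightarrow> bool" where
  "contains_b \<Gamma> \<longleftrightarrow> (\<exists>v1 v2 v3 v4 v5. distinct [v1, v2, v3, v4, v5] \<and>
     {v1, v2} \<in> neg_edges \<Gamma> \<and>
     {{v1, v3}, {v2, v3}, {v1, v4}, {v3, v4}, {v2, v5}, {v3, v5}} \<subseteq> pos_edges \<Gamma>)"

definition contains_c :: "'a sgraph \<Rightarrow> bool" where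
  "contains_c \<Gamma> \<longleftrightarrow> (\<exists>x y z1 z2 z3. distinct [x, y, z1, z2, z3] \<and>
     {x, y} \<in> pos_edges \<Gamma> \<and>
     (\<forall>z\<in>{z1, z2, z3}.
        {x, z} \<in> pos_edges \<Gamma> \<and> {y, z} \<in> neg_edges \<Gamma> \<or>
        {x, z} \<in> neg_edges \<Gamma> \<and> {y, z} \<in> pos_edges \<Gamma>))"


subsection \<open>The C.C Algorithm\<close>

text \<open>The condition is vacuously true for isolated vertices.\<close>

definition step1_vertices :: "'a sgraph \<Rightarrow> 'a set" where
  "step1_vertices \<Gamma> = {v \<in> vertices \<Gamma>. \<forall>e\<in>edges \<Gamma>. v \<in> e \<longrightarrow> e \<in> neg_edges \<Gamma>}"

definition singletons :: "'a set \<Rightarrow> 'a set set" where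
  "singletons A = (\<lambda>v. {v}) ` A"

definition pos_triangles :: "'a sgraph \<Rightarrow> 'a set set" where
  "pos_triangles \<Gamma> = {set vs | vs. cycle \<Gamma> vs \<and> length vs = 3 \<and> strongly_positive \<Gamma> vs}"

text \<open>Two triangles with a common edge have a common vertex, so only common vertices are
  mentioned. Being connected is understood transitively: there is one cluster for every
  class of the transitive closure of this relation.\<close>

definition touching :: "'a set set \<Rightarrow> ('a set \<times> 'a set) set" where
  "touching \<T> = {(S, T). S \<in> \<T> \<and> T \<in> \<T> \<and> S \<inter> T \<noteq> {}}"

definition step2_clusters :: "'a sgraph \<Rightarrow> 'a set set" where
  "step2_clusters \<Gamma> =
     {\<Union> ((touching (pos_triangles \<Gamma>))\<^sup>+ `` {T}) | T. T \<in> pos_triangles \<Gamma>}"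

definition pos_matching :: "'a sgraph \<Rightarrow> 'a set set \<Rightarrow> bool" where
  "pos_matching \<Gamma> M \<longleftrightarrow> M \<subseteq> pos_edges \<Gamma> \<and> disjoint M"

definition max_pos_matching :: "'a sgraph \<Rightarrow> 'a set set \<Rightarrow> bool" where
  "max_pos_matching \<Gamma> M \<longleftrightarrow>
     pos_matching \<Gamma> M \<and> (\<forall>M'. pos_matching \<Gamma> M' \<longrightarrow> card M' \<le> card M)"

definition pos_degree :: "'a sgraph \<Rightarrow> 'a set \<Rightarrow> 'a set \<Rightarrow> nat" where
  "pos_degree \<Gamma> K L = card {{x, y} | x y. x \<in> K \<and> y \<in> L \<and> {x, y} \<in> pos_edges \<Gamma>}"

definition neg_degree :: "'a sgraph \<Rightarrow> 'a set \<Rightarrow> 'a set \<Rightarrow> nat" where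
  "neg_degree \<Gamma> K L = card {{x, y} | x y. x \<in> K \<and> y \<in> L \<and> {x, y} \<in> neg_edges \<Gamma>}"

definition mergeable :: "'a sgraph \<Rightarrow> 'a set set \<Rightarrow> 'a set \<Rightarrow> 'a set \<Rightarrow> bool" where
  "mergeable \<Gamma> C K L \<longleftrightarrow>
     K \<in> C \<and> L \<in> C \<and> K \<noteq> L \<and> neg_degree \<Gamma> K L = 0 \<and> pos_degree \<Gamma> K L \<ge> 1"

definition merge_step :: "'a sgraph \<Rightarrow> 'a set set \<Rightarrow> 'a set set \<Rightarrow> bool" where
  "merge_step \<Gamma> C C' \<longleftrightarrow> (\<exists>K L. mergeable \<Gamma> C K L \<and>
     (\<forall>K' L'. mergeable \<Gamma> C K' L' \<longrightarrow> pos_degree \<Gamma> K' L' \<le> pos_degree \<Gamma> K L) \<and>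
     C' = insert (K \<union> L) (C - {K, L}))"

text \<open>The algorithm chooses a maximum matching and breaks ties between merges arbitrarily, so
  its possible outputs are described by a relation. The clusters \<open>C0\<close> are those of steps
  (2) to (4); merging uses the degrees in the whole graph, and the clusters of step (1)
  take no part in it.\<close>

definition cc_output :: "'a sgraph \<Rightarrow> 'a set set \<Rightarrow> bool" where
  "cc_output \<Gamma> Sol \<longleftrightarrow> (\<exists>A \<Gamma>1 T \<Gamma>2 M C0 C.
     A = step1_vertices \<Gamma> \<and>
     \<Gamma>1 = remove_vertices \<Gamma> A \<and>
     T = step2_clusters \<Gamma>1 \<and>
     \<Gamma>2 = remove_vertices \<Gamma>1 (\<Union>T) \<and>
     max_pos_matching \<Gamma>2 M \<and>
     C0 = T \<union> M \<union> singletons (vertices \<Gamma>2 - \<Union>M) \<and>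
     (merge_step \<Gamma>)\<^sup>*\<^sup>* C0 C \<and>
     (\<nexists>K L. mergeable \<Gamma> C K L) \<and>
     Sol = singletons A \<union> C)"


subsection \<open>Well-definedness\<close>

text \<open>The minimum in \<open>opt_disagreements\<close> ranges over a finite nonempty set, the algorithm
  has at least one output, and all its outputs are clusterings.\<close>

lemma clusterings_finite_nonempty:
  assumes "signed_graph \<Gamma>"
  shows "finite {C. clustering \<Gamma> C}" and "{C. clustering \<Gamma> C} \<noteq> {}"
proof -
  have "{C. clustering \<Gamma> C} \<subseteq> Pow (Pow (vertices \<Gamma>))"
    by (auto simp: clustering_def partition_on_def)
  moreover have "finite (Pow (Pow (vertices \<Gamma>)))"
    using assms by (simp add: signed_graph_def)
  ultimately show "finite {C. clustering \<Gamma> C}"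
    by (rule finite_subset)
  have "partition_on (vertices \<Gamma>) ((\<lambda>v. {v}) ` vertices \<Gamma>)"
    by (rule partition_on_singletons)
  then show "{C. clustering \<Gamma> C} \<noteq> {}"
    by (auto simp: clustering_def)
qed

lemma opt_disagreements_le:
  assumes "signed_graph \<Gamma>" and "clustering \<Gamma> C"
  shows "opt_disagreements \<Gamma> \<le> num_disagreements \<Gamma> C"
proof -
  have "finite {num_disagreements \<Gamma> C | C. clustering \<Gamma> C}"
    using clusterings_finite_nonempty(1)[OF assms(1)] by (simp add: setcompr_eq_image)
  then show ?thesis
    unfolding opt_disagreements_def using assms(2) by (intro Min_le) auto
qed

lemma opt_disagreements_attained:
  assumes "signed_graph \<Gamma>"
  shows "\<exists>C. clustering \<Gamma> C \<and> num_disagreements \<Gamma> C = opt_disagreements \<Gamma>"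
proof -
  have "opt_disagreements \<Gamma> \<in> {num_disagreements \<Gamma> C | C. clustering \<Gamma> C}"
    unfolding opt_disagreements_def using clusterings_finite_nonempty[OF assms]
    by (intro Min_in) (auto simp: setcompr_eq_image)
  then show ?thesis by auto
qed

lemma partition_on_Un_disjnt:
  assumes "disjnt A B" and "partition_on A P" and "partition_on B Q"
  shows "partition_on (A \<union> B) (P \<union> Q)"
  unfolding partition_on_def
proof (intro conjI)
  show "\<Union> (P \<union> Q) = A \<union> B" "{} \<notin> P \<union> Q"
    using assms(2,3) by (simp_all add: partition_on_def)
  show "disjoint (P \<union> Q)"
    using assms by (intro disjoint_union) (simp_all add: partition_on_def disjnt_def)
qed

lemma partition_on_singleton_clusters: "partition_on A (singletons A)"
  unfolding singletons_def by (rule partition_on_singletons)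

lemma partition_on_step2_clusters:
  "partition_on (\<Union> (pos_triangles \<Gamma>)) (step2_clusters \<Gamma>)"
proof -
  let ?T = "pos_triangles \<Gamma>"
  let ?R = "(touching ?T)\<^sup>+"
  have ne: "S \<noteq> {}" if "S \<in> ?T" for S
    using that by (auto simp: pos_triangles_def)
  have "sym (touching ?T)"
    by (auto simp: touching_def sym_def)
  then have sy: "sym ?R" by (rule sym_trancl)
  have tr: "trans ?R" by simp
  have fld: "?R \<subseteq> ?T \<times> ?T"
    by (rule trancl_subset_Sigma) (auto simp: touching_def)
  have refl: "(S, S) \<in> ?R" if "S \<in> ?T" for S
    using that ne by (auto simp: touching_def)
  have same: "?R `` {S} = ?R `` {T}" if "v \<in> \<Union> (?R `` {S})" "v \<in> \<Union> (?R `` {T})" for v S T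
  proof -
    obtain S' T' where a: "(S, S') \<in> ?R" "v \<in> S'" "(T, T') \<in> ?R" "v \<in> T'"
      using \<open>v \<in> \<Union> (?R `` {S})\<close> \<open>v \<in> \<Union> (?R `` {T})\<close> by auto
    then have "(S', T') \<in> touching ?T"
      using fld by (auto simp: touching_def)
    then have "(S, T) \<in> ?R"
      using a sy tr by (meson r_into_trancl' symD transD)
    then show ?thesis
      using sy tr by (auto dest: symD transD)
  qed
  show ?thesis
  proof (rule partition_onI)
    have "?R `` {T} \<subseteq> ?T" for T
      using fld by blast
    then have "\<Union> (step2_clusters \<Gamma>) \<subseteq> \<Union> ?T"
      unfolding step2_clusters_def by blast
    moreover have "\<Union> ?T \<subseteq> \<Union> (step2_clusters \<Gamma>)"
      unfolding step2_clusters_def using refl by blast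
    ultimately show "\<Union> (step2_clusters \<Gamma>) = \<Union> ?T"
      by blast
  next
    fix p q assume "p \<in> step2_clusters \<Gamma>" "q \<in> step2_clusters \<Gamma>" "p \<noteq> q"
    then obtain S T where st: "p = \<Union> (?R `` {S})" "q = \<Union> (?R `` {T})"
      by (auto simp: step2_clusters_def)
    show "disjnt p q"
    proof (rule ccontr)
      assume "\<not> disjnt p q"
      then obtain v where "v \<in> p" "v \<in> q" by (auto simp: disjnt_def)
      then have "?R `` {S} = ?R `` {T}" using same st by blast
      then show False using st \<open>p \<noteq> q\<close> by simp
    qed
  next
    have "\<Union> (?R `` {T}) \<noteq> {}" if "T \<in> ?T" for T
      using refl[OF that] ne[OF that] by blast
    then show "{} \<notin> step2_clusters \<Gamma>"
      unfolding step2_clusters_def by (smt (verit, best) mem_Collect_eq)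
  qed
qed

lemma partition_on_initial:
  assumes "signed_graph \<Gamma>" and "A = step1_vertices \<Gamma>"
    and "\<Gamma>1 = remove_vertices \<Gamma> A" and "T = step2_clusters \<Gamma>1"
    and "\<Gamma>2 = remove_vertices \<Gamma>1 (\<Union>T)" and "pos_matching \<Gamma>2 M"
  shows "partition_on (vertices \<Gamma> - A) (T \<union> M \<union> singletons (vertices \<Gamma>2 - \<Union>M))"
proof -
  have T: "partition_on (\<Union>T) T"
    using partition_on_step2_clusters[of \<Gamma>1] assms(4) by (auto simp: partition_on_def)
  have "\<Union>T = \<Union> (pos_triangles \<Gamma>1)"
    using partition_on_step2_clusters[of \<Gamma>1] assms(4) by (auto simp: partition_on_def)
  then have TV: "\<Union>T \<subseteq> vertices \<Gamma> - A"
    using assms(3) by (auto simp: pos_triangles_def cycle_def remove_vertices_def)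
  have V2: "vertices \<Gamma>2 = vertices \<Gamma> - A - \<Union>T"
    using assms(3,5) by (simp add: remove_vertices_def)
  have e: "e \<subseteq> vertices \<Gamma>2 \<and> e \<noteq> {}" if "e \<in> M" for e
  proof -
    have "e \<in> edges \<Gamma>2" using that assms(6) by (auto simp: pos_matching_def pos_edges_def)
    then have "e \<in> edges \<Gamma>" "e \<inter> A = {}" "e \<inter> \<Union>T = {}"
      using assms(3,5) by (auto simp: remove_vertices_def)
    moreover have "e \<subseteq> vertices \<Gamma>" "e \<noteq> {}"
      using \<open>e \<in> edges \<Gamma>\<close> assms(1) by (auto simp: signed_graph_def)
    ultimately show ?thesis using V2 by auto
  qed
  have M: "partition_on (\<Union>M) M"
    using e assms(6) by (auto simp: partition_on_def pos_matching_def)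
  have MV: "\<Union>M \<subseteq> vertices \<Gamma>2" using e by auto
  have 1: "disjnt (\<Union>T) (\<Union>M)" and 2: "disjnt (\<Union>T \<union> \<Union>M) (vertices \<Gamma>2 - \<Union>M)"
    using MV V2 by (auto simp: disjnt_def)
  have "\<Union>T \<union> \<Union>M \<union> (vertices \<Gamma>2 - \<Union>M) = vertices \<Gamma> - A"
    using TV MV V2 by auto
  then show ?thesis
    using partition_on_Un_disjnt[OF 2 partition_on_Un_disjnt[OF 1 T M] partition_on_singleton_clusters] by simp
qed

lemma merge_step_partition:
  assumes "merge_step \<Gamma> C C'" and "partition_on V C"
  shows "partition_on V C'"
proof -
  obtain K L where KL: "K \<in> C" "L \<in> C" "C' = insert (K \<union> L) (C - {K, L})"
    using assms(1) by (auto simp: merge_step_def mergeable_def)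
  show ?thesis
  proof (rule partition_onI)
    show "\<Union> C' = V" using assms(2) KL by (auto simp: partition_on_def)
    show "{} \<notin> C'" using assms(2) KL by (auto simp: partition_on_def)
    have dj: "disjnt p q" if "p \<in> C" "q \<in> C" "p \<noteq> q" for p q
      using assms(2) that by (auto simp: partition_on_def pairwise_def)
    have new: "disjnt (K \<union> L) p" if "p \<in> C - {K, L}" for p
      using that KL dj[of K p] dj[of L p] by auto
    fix p q assume "p \<in> C'" "q \<in> C'" "p \<noteq> q"
    then consider "p = K \<union> L" "q \<in> C - {K, L}" | "q = K \<union> L" "p \<in> C - {K, L}" | "p \<in> C" "q \<in> C"
      using KL(3) by blast
    then show "disjnt p q"
      by cases (use new dj \<open>p \<noteq> q\<close> disjnt_sym in \<open>blast+\<close>)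
  qed
qed

lemma merge_steps_partition:
  "(merge_step \<Gamma>)\<^sup>*\<^sup>* C C' \<Longrightarrow> partition_on V C \<Longrightarrow> partition_on V C'"
  by (induction rule: rtranclp_induct) (auto intro: merge_step_partition)

theorem cc_output_clustering:
  assumes "signed_graph \<Gamma>" and "cc_output \<Gamma> Sol"
  shows "clustering \<Gamma> Sol"
proof -
  obtain \<Gamma>1 T \<Gamma>2 M C0 C where *:
    "\<Gamma>1 = remove_vertices \<Gamma> (step1_vertices \<Gamma>)" "T = step2_clusters \<Gamma>1"
    "\<Gamma>2 = remove_vertices \<Gamma>1 (\<Union>T)" "max_pos_matching \<Gamma>2 M"
    "C0 = T \<union> M \<union> singletons (vertices \<Gamma>2 - \<Union>M)" "(merge_step \<Gamma>)\<^sup>*\<^sup>* C0 C"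
    "Sol = singletons (step1_vertices \<Gamma>) \<union> C"
    using assms(2) unfolding cc_output_def by blast
  have "partition_on (vertices \<Gamma> - step1_vertices \<Gamma>) C0"
    using partition_on_initial[OF assms(1) refl *(1-3)] *(4,5) by (simp add: max_pos_matching_def)
  then have C: "partition_on (vertices \<Gamma> - step1_vertices \<Gamma>) C"
    using *(6) merge_steps_partition by blast
  have V: "step1_vertices \<Gamma> \<union> (vertices \<Gamma> - step1_vertices \<Gamma>) = vertices \<Gamma>"
    by (auto simp: step1_vertices_def)
  have "disjnt (step1_vertices \<Gamma>) (vertices \<Gamma> - step1_vertices \<Gamma>)"
    by (auto simp: disjnt_def)
  from partition_on_Un_disjnt[OF this partition_on_singleton_clusters C]
  show ?thesis unfolding clustering_def *(7) V .
qed

lemma max_pos_matching_exists: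
  assumes "finite (edges \<Gamma>)"
  shows "\<exists>M. max_pos_matching \<Gamma> M"
proof -
  have "M \<subseteq> edges \<Gamma>" if "pos_matching \<Gamma> M" for M
    using that by (auto simp: pos_matching_def pos_edges_def)
  then have "\<forall>M. pos_matching \<Gamma> M \<longrightarrow> card M < Suc (card (edges \<Gamma>))"
    by (simp add: assms card_mono less_Suc_eq_le)
  moreover have "pos_matching \<Gamma> {}" by (simp add: pos_matching_def)
  ultimately obtain M where "pos_matching \<Gamma> M" "\<forall>M'. pos_matching \<Gamma> M' \<longrightarrow> card M' \<le> card M"
    using ex_has_greatest_nat[of "pos_matching \<Gamma>" "{}" card "Suc (card (edges \<Gamma>))"] by auto
  then show ?thesis by (auto simp: max_pos_matching_def)
qed

lemma merge_step_exists:
  assumes "finite C" and "mergeable \<Gamma> C K L"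
  shows "\<exists>C'. merge_step \<Gamma> C C'"
proof -
  let ?S = "{(K, L). mergeable \<Gamma> C K L}"
  have "?S \<subseteq> C \<times> C" by (auto simp: mergeable_def)
  then have fin: "finite ?S" using assms(1) finite_subset by blast
  let ?d = "\<lambda>(K, L). pos_degree \<Gamma> K L"
  have "Max (?d ` ?S) \<in> ?d ` ?S"
    using fin assms(2) by (intro Max_in) auto
  then obtain K0 L0 where m: "mergeable \<Gamma> C K0 L0" "pos_degree \<Gamma> K0 L0 = Max (?d ` ?S)"
    by auto
  have "pos_degree \<Gamma> K' L' \<le> pos_degree \<Gamma> K0 L0" if "mergeable \<Gamma> C K' L'" for K' L'
    unfolding m(2) using fin that by (intro Max_ge) force+
  then show ?thesis using m(1) by (auto simp: merge_step_def)
qed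

lemma merging_terminates:
  assumes "finite C"
  shows "\<exists>C'. (merge_step \<Gamma>)\<^sup>*\<^sup>* C C' \<and> (\<nexists>K L. mergeable \<Gamma> C' K L)"
  using assms
proof (induction "card C" arbitrary: C rule: less_induct)
  case less
  show ?case
  proof (cases "\<exists>K L. mergeable \<Gamma> C K L")
    case False
    then show ?thesis by blast
  next
    case True
    then obtain C1 where C1: "merge_step \<Gamma> C C1"
      using merge_step_exists less.prems by blast
    then obtain K L where KL: "K \<in> C" "L \<in> C" "K \<noteq> L" "C1 = insert (K \<union> L) (C - {K, L})"
      by (auto simp: merge_step_def mergeable_def)
    have "card {K, L} \<le> card C"
      using KL less.prems by (intro card_mono) auto
    moreover have "card (C - {K, L}) = card C - 2"
      using KL less.prems by (simp add: card_Diff_subset)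
    ultimately have "card C1 < card C"
      using KL less.prems card_insert_le_m1[of "card C - 1" "C - {K, L}" "K \<union> L"] by simp
    moreover have "finite C1" using KL less.prems by simp
    ultimately show ?thesis
      using less.hyps C1 by (meson converse_rtranclp_into_rtranclp)
  qed
qed

theorem cc_output_exists:
  assumes "signed_graph \<Gamma>"
  shows "\<exists>Sol. cc_output \<Gamma> Sol"
proof -
  define \<Gamma>1 where "\<Gamma>1 = remove_vertices \<Gamma> (step1_vertices \<Gamma>)"
  define T where "T = step2_clusters \<Gamma>1"
  define \<Gamma>2 where "\<Gamma>2 = remove_vertices \<Gamma>1 (\<Union>T)"
  have "edges \<Gamma> \<subseteq> Pow (vertices \<Gamma>)" using assms by (auto simp: signed_graph_def)
  then have "finite (edges \<Gamma>)"
    using assms by (meson finite_Pow_iff finite_subset signed_graph_def)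
  then have "finite (edges \<Gamma>2)" by (simp add: \<Gamma>1_def \<Gamma>2_def remove_vertices_def)
  then obtain M where M: "max_pos_matching \<Gamma>2 M" using max_pos_matching_exists by blast
  let ?C = "T \<union> M \<union> singletons (vertices \<Gamma>2 - \<Union>M)"
  have "partition_on (vertices \<Gamma> - step1_vertices \<Gamma>) ?C"
    using partition_on_initial[OF assms refl \<Gamma>1_def T_def \<Gamma>2_def] M
    by (simp add: max_pos_matching_def)
  then have "finite ?C"
    using assms by (intro finite_elements) (auto simp: signed_graph_def)
  then obtain C where C: "(merge_step \<Gamma>)\<^sup>*\<^sup>* ?C C" "\<nexists>K L. mergeable \<Gamma> C K L"
    using merging_terminates[of ?C \<Gamma>] by metis
  have "cc_output \<Gamma> (singletons (step1_vertices \<Gamma>) \<union> C)"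
    unfolding cc_output_def
    by (rule exI[of _ "step1_vertices \<Gamma>"], rule exI[of _ \<Gamma>1], rule exI[of _ T],
        rule exI[of _ \<Gamma>2], rule exI[of _ M], rule exI[of _ ?C], rule exI[of _ C],
        intro conjI refl \<Gamma>1_def T_def \<Gamma>2_def M C)
  then show ?thesis by blast
qed

end

theory Submission
  imports Defs
begin

text \<open>
  Let a bad triangle be a weakly negative triangle, that is, two positive edges and one negative
  edge. The number of bad triangles lies between the number of disagreements of the output and
  twice the optimum.

  It is at most twice the optimum: no clustering agrees with all three edges of a bad triangle,
  so every bad triangle contains a disagreement of every clustering. Without (a), a negative edge
  lies in at most one bad triangle; without (c), a positive edge lies in at most two. Hence there
  are at most \<open>2 * d\<close> bad triangles if some clustering has \<open>d\<close> disagreements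
  (\<open>bad_triangles_le_twice_disagreements\<close>).

  It is at least the number of disagreements of the output, because these can be mapped
  injectively to bad triangles. The output has no negative edge inside a cluster: for the clusters
  made of strongly positive triangles this is forced by (a) and (b) (\<open>triangle_connected_pos\<close>),
  and merging only joins clusters without negative edges between them. So every disagreement is a
  positive edge between two clusters \<open>K\<close> and \<open>L\<close>, none of them from step (1). As they could not
  be merged any more, there is also a negative edge between them. Then each positive edge between
  \<open>K\<close> and \<open>L\<close> lies in a bad triangle inside \<open>K \<union> L\<close> (\<open>cut_edge_in_bad_triangle\<close>). The other two
  edges of this triangle are a positive edge inside one of the clusters and a negative edge, so
  the given edge can be recovered from the triangle (\<open>charges_inj\<close>).

  Both times a triangle has to be found, it comes from one lemma on induced cycles,
  \<open>chord_closes_triangle\<close>: if the ends of an edge outside a set \<open>R\<close> of positive edges are joined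
  by a path in \<open>R\<close>, then some edge outside \<open>R\<close> closes a path of just two edges of \<open>R\<close>.
\<close>

section \<open>Edges and triangles\<close>

lemma edge_ne:
  assumes "signed_graph \<Gamma>" and "{a, b} \<in> edges \<Gamma>"
  shows "a \<noteq> b"
proof -
  have "card {a, b} = 2"
    using assms by (simp add: signed_graph_def)
  then show ?thesis by auto
qed

lemma edge_in_vertices:
  assumes "signed_graph \<Gamma>" and "{a, b} \<in> edges \<Gamma>"
  shows "a \<in> vertices \<Gamma>" and "b \<in> vertices \<Gamma>"
proof -
  have "{a, b} \<subseteq> vertices \<Gamma>"
    using assms by (simp only: signed_graph_def)
  then show "a \<in> vertices \<Gamma>" and "b \<in> vertices \<Gamma>" by simp_all
qed

lemma finite_edges:
  assumes "signed_graph \<Gamma>"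
  shows "finite (edges \<Gamma>)"
proof -
  have "edges \<Gamma> \<subseteq> Pow (vertices \<Gamma>)"
    using assms by (auto simp: signed_graph_def)
  then show ?thesis
    using assms by (meson finite_Pow_iff finite_subset signed_graph_def)
qed

lemma pos_edges_subset: "pos_edges \<Gamma> \<subseteq> edges \<Gamma>"
  by (auto simp: pos_edges_def)

lemma neg_edges_subset: "neg_edges \<Gamma> \<subseteq> edges \<Gamma>"
  by (auto simp: neg_edges_def)

lemma pos_neg_disjoint: "e \<in> pos_edges \<Gamma> \<Longrightarrow> e \<notin> neg_edges \<Gamma>"
  by (auto simp: pos_edges_def neg_edges_def)

lemma edge_pos_or_neg:
  assumes "signed_graph \<Gamma>" and "e \<in> edges \<Gamma>"
  shows "e \<in> pos_edges \<Gamma> \<or> e \<in> neg_edges \<Gamma>"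
  using assms by (auto simp: signed_graph_def pos_edges_def neg_edges_def)

lemma edge_doubleton:
  assumes "signed_graph \<Gamma>" and "e \<in> edges \<Gamma>"
  obtains a b where "e = {a, b}"
proof -
  have "card e = 2"
    using assms by (simp add: signed_graph_def)
  then show thesis
    using that by (auto simp: card_2_iff)
qed

lemma pos_edge_ne:
  assumes "signed_graph \<Gamma>" and "{a, b} \<in> pos_edges \<Gamma>"
  shows "a \<noteq> b"
  using edge_ne[OF assms(1) subsetD[OF pos_edges_subset assms(2)]] .

lemma neg_edge_ne:
  assumes "signed_graph \<Gamma>" and "{a, b} \<in> neg_edges \<Gamma>"
  shows "a \<noteq> b"
  using edge_ne[OF assms(1) subsetD[OF neg_edges_subset assms(2)]] .

definition bad_triangles :: "'a sgraph \<Rightarrow> 'a set set" where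
  "bad_triangles \<Gamma> =
     {{x, y, z} | x y z. {x, y} \<in> pos_edges \<Gamma> \<and> {x, z} \<in> pos_edges \<Gamma> \<and> {y, z} \<in> neg_edges \<Gamma>}"

lemma finite_bad_triangles:
  assumes "signed_graph \<Gamma>"
  shows "finite (bad_triangles \<Gamma>)"
proof -
  have "bad_triangles \<Gamma> \<subseteq> Pow (vertices \<Gamma>)"
  proof
    fix T assume "T \<in> bad_triangles \<Gamma>"
    then obtain x y z where "T = {x, y, z}" "{x, y} \<in> edges \<Gamma>" "{x, z} \<in> edges \<Gamma>"
      using pos_edges_subset unfolding bad_triangles_def by blast
    then show "T \<in> Pow (vertices \<Gamma>)"
      using edge_in_vertices[OF assms] by blast
  qed
  then show ?thesis
    using assms by (meson finite_Pow_iff finite_subset signed_graph_def)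
qed

lemma cycle_edges_eq_image:
  "cycle_edges vs = (\<lambda>i. {vs ! i, vs ! (Suc i mod length vs)}) ` {..<length vs}"
  by (auto simp: cycle_edges_def)

lemma cycle_edges_3: "cycle_edges [a, b, c] = {{a, b}, {a, c}, {b, c}}"
proof -
  have "{..<length [a, b, c]} = {0, 1, 2}" by auto
  then show ?thesis
    unfolding cycle_edges_eq_image by (simp add: insert_commute)
qed

lemma pos_triangles_eq:
  assumes "signed_graph \<Gamma>"
  shows "pos_triangles \<Gamma> =
    {{a, b, c} | a b c. {a, b} \<in> pos_edges \<Gamma> \<and> {a, c} \<in> pos_edges \<Gamma> \<and> {b, c} \<in> pos_edges \<Gamma>}"
    (is "_ = ?T")
proof (intro subset_antisym subsetI)
  note ce = cycle_edges_3
  fix T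
  show "T \<in> ?T" if T: "T \<in> pos_triangles \<Gamma>"
  proof -
    obtain vs where vs: "T = set vs" "length vs = 3" "strongly_positive \<Gamma> vs"
      using T by (auto simp: pos_triangles_def)
    then obtain a b c where "vs = [a, b, c]"
      by (auto simp: numeral_3_eq_3 length_Suc_conv)
    then show ?thesis
      using vs by (fastforce simp: strongly_positive_def ce)
  qed
  show "T \<in> pos_triangles \<Gamma>" if T': "T \<in> ?T"
  proof -
    obtain a b c where T: "T = {a, b, c}"
      and e: "{a, b} \<in> pos_edges \<Gamma>" "{a, c} \<in> pos_edges \<Gamma>" "{b, c} \<in> pos_edges \<Gamma>"
      using T' by blast
    then have e': "{a, b} \<in> edges \<Gamma>" "{a, c} \<in> edges \<Gamma>" "{b, c} \<in> edges \<Gamma>"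
      using pos_edges_subset by blast+
    have "cycle \<Gamma> [a, b, c]"
      using e' edge_ne[OF assms] edge_in_vertices[OF assms] by (auto simp: cycle_def ce)
    moreover have "strongly_positive \<Gamma> [a, b, c]"
      using e by (simp add: strongly_positive_def ce)
    ultimately have "set [a, b, c] \<in> pos_triangles \<Gamma>"
      unfolding pos_triangles_def by fastforce
    then show ?thesis by (simp add: T)
  qed
qed

lemma pos_triangle_pair:
  assumes "signed_graph \<Gamma>" and "S \<in> pos_triangles \<Gamma>" and "x \<in> S" and "y \<in> S" and "x \<noteq> y"
  shows "{x, y} \<in> pos_edges \<Gamma>"
  using assms(2-) unfolding pos_triangles_eq[OF assms(1)] by (auto simp: insert_commute)


section \<open>Every edge lies in at most two weakly negative triangles\<close>

lemma card_le_2I: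
  assumes "finite A" and "\<And>a b c. \<lbrakk>a \<in> A; b \<in> A; c \<in> A; distinct [a, b, c]\<rbrakk> \<Longrightarrow> False"
  shows "card A \<le> 2"
proof (rule ccontr)
  assume "\<not> card A \<le> 2"
  then obtain B where "B \<subseteq> A" "card B = 3"
    using obtain_subset_with_card_n[of 3 A] by auto
  then obtain a b c where "B = {a, b, c}" "distinct [a, b, c]"
    by (auto simp: card_3_iff)
  then show False using assms(2)[of a b c] \<open>B \<subseteq> A\<close> by simp
qed

lemma bad_triangle_neg_edge:
  assumes "signed_graph \<Gamma>" and "T \<in> bad_triangles \<Gamma>" and "{u, v} \<in> neg_edges \<Gamma>" and "{u, v} \<subseteq> T"
  obtains z where "T = {u, v, z}" "{u, z} \<in> pos_edges \<Gamma>" "{v, z} \<in> pos_edges \<Gamma>"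
proof -
  obtain x y z where T: "T = {x, y, z}" "{x, y} \<in> pos_edges \<Gamma>" "{x, z} \<in> pos_edges \<Gamma>"
    using assms(2) by (auto simp: bad_triangles_def)
  have "u \<noteq> v" using neg_edge_ne assms(1,3) by metis
  then have "{u, v} = {x, y} \<or> {u, v} = {x, z} \<or> {u, v} = {y, z}"
    using assms(4) T(1) by auto
  then have "{u, v} = {y, z}"
    using T assms(3) pos_neg_disjoint by metis
  then have "u = y \<and> v = z \<or> u = z \<and> v = y" by (auto simp: doubleton_eq_iff)
  then show thesis
    using that[of x] T by (auto simp: insert_commute)
qed

lemma bad_triangle_pos_edge:
  assumes "signed_graph \<Gamma>" and "T \<in> bad_triangles \<Gamma>" and "{u, v} \<in> pos_edges \<Gamma>" and "{u, v} \<subseteq> T"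
  obtains z where "T = {u, v, z}" and
    "{u, z} \<in> pos_edges \<Gamma> \<and> {v, z} \<in> neg_edges \<Gamma> \<or> {u, z} \<in> neg_edges \<Gamma> \<and> {v, z} \<in> pos_edges \<Gamma>"
proof -
  obtain x y z where T: "T = {x, y, z}" "{x, y} \<in> pos_edges \<Gamma>" "{x, z} \<in> pos_edges \<Gamma>"
      "{y, z} \<in> neg_edges \<Gamma>"
    using assms(2) by (auto simp: bad_triangles_def)
  have "u \<noteq> v" using pos_edge_ne assms(1,3) by metis
  moreover have "{u, v} \<noteq> {y, z}"
    using T assms(3) pos_neg_disjoint by metis
  ultimately have "{u, v} = {x, y} \<or> {u, v} = {x, z}"
    using assms(4) T(1) by auto
  then consider "u = x" "v = y" | "u = y" "v = x" | "u = x" "v = z" | "u = z" "v = x"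
    by (auto simp: doubleton_eq_iff)
  then show thesis
  proof cases
    case 1 with that[of z] T show thesis by (simp add: insert_commute)
  next
    case 2 with that[of z] T show thesis by (simp add: insert_commute)
  next
    case 3 with that[of y] T show thesis by (simp add: insert_commute)
  next
    case 4 with that[of y] T show thesis by (simp add: insert_commute)
  qed
qed

text \<open>Two bad triangles on a common negative edge form the graph (a); three on a common positive
  edge form the graph (c).\<close>

lemma edge_in_at_most_two_bad_triangles:
  assumes "signed_graph \<Gamma>" and "\<not> contains_a \<Gamma>" and "\<not> contains_c \<Gamma>" and "e \<in> edges \<Gamma>"
  shows "card {T \<in> bad_triangles \<Gamma>. e \<subseteq> T} \<le> 2"
proof (rule card_le_2I)
  show "finite {T \<in> bad_triangles \<Gamma>. e \<subseteq> T}"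
    using finite_bad_triangles[OF assms(1)] by simp
  fix T1 T2 T3
  assume T: "T1 \<in> {T \<in> bad_triangles \<Gamma>. e \<subseteq> T}" "T2 \<in> {T \<in> bad_triangles \<Gamma>. e \<subseteq> T}"
      "T3 \<in> {T \<in> bad_triangles \<Gamma>. e \<subseteq> T}" "distinct [T1, T2, T3]"
  obtain u v where e: "e = {u, v}" using edge_doubleton assms(1,4) by metis
  show False
  proof (cases "e \<in> neg_edges \<Gamma>")
    case True
    then have n: "{u, v} \<in> neg_edges \<Gamma>" using e by simp
    obtain z1 where z1: "T1 = {u, v, z1}" "{u, z1} \<in> pos_edges \<Gamma>" "{v, z1} \<in> pos_edges \<Gamma>"
      using bad_triangle_neg_edge[OF assms(1) _ n] T(1) e by auto
    obtain z2 where z2: "T2 = {u, v, z2}" "{u, z2} \<in> pos_edges \<Gamma>" "{v, z2} \<in> pos_edges \<Gamma>"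
      using bad_triangle_neg_edge[OF assms(1) _ n] T(2) e by auto
    have "distinct [u, v, z1, z2]"
      using T(4) z1 z2 n pos_edge_ne[OF assms(1)] neg_edge_ne[OF assms(1)] by auto
    then have "contains_a \<Gamma>"
      using z1 z2 n unfolding contains_a_def by blast
    then show False using assms(2) by simp
  next
    case False
    then have p: "{u, v} \<in> pos_edges \<Gamma>"
      using edge_pos_or_neg[OF assms(1,4)] e by simp
    let ?Z = "\<lambda>z. {u, z} \<in> pos_edges \<Gamma> \<and> {v, z} \<in> neg_edges \<Gamma> \<or>
        {u, z} \<in> neg_edges \<Gamma> \<and> {v, z} \<in> pos_edges \<Gamma>"
    obtain z1 where z1: "T1 = {u, v, z1}" "?Z z1"
      using bad_triangle_pos_edge[OF assms(1) _ p, of T1] T(1) e by blast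
    obtain z2 where z2: "T2 = {u, v, z2}" "?Z z2"
      using bad_triangle_pos_edge[OF assms(1) _ p, of T2] T(2) e by blast
    obtain z3 where z3: "T3 = {u, v, z3}" "?Z z3"
      using bad_triangle_pos_edge[OF assms(1) _ p, of T3] T(3) e by blast
    have ne: "u \<noteq> z \<and> v \<noteq> z" if "?Z z" for z
      using that pos_edge_ne[OF assms(1)] neg_edge_ne[OF assms(1)] by metis
    have "distinct [u, v, z1, z2, z3]"
      using T(4) z1(1) z2(1) z3(1) ne[OF z1(2)] ne[OF z2(2)] ne[OF z3(2)]
        pos_edge_ne[OF assms(1) p] by auto
    moreover have "\<forall>z\<in>{z1, z2, z3}. ?Z z"
      using z1(2) z2(2) z3(2) by blast
    ultimately have "contains_c \<Gamma>"
      using p unfolding contains_c_def by blast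
    then show False using assms(3) by simp
  qed
qed

lemma pos_disagreementI:
  assumes "{x, y} \<in> pos_edges \<Gamma>" "x \<in> K" "y \<in> L" "K \<in> C" "L \<in> C" "K \<noteq> L"
  shows "{x, y} \<in> disagreements \<Gamma> C"
  unfolding disagreements_def using assms
  by (intro UnI2 CollectI exI[of _ x] exI[of _ y] conjI bexI[of _ K] bexI[of _ L]) auto

lemma neg_disagreementI:
  assumes "{x, y} \<in> neg_edges \<Gamma>" "x \<in> K" "y \<in> K" "K \<in> C"
  shows "{x, y} \<in> disagreements \<Gamma> C"
  unfolding disagreements_def using assms
  by (intro UnI1 CollectI exI[of _ x] exI[of _ y] conjI bexI[of _ K]) auto

lemma finite_disagreements:
  assumes "signed_graph \<Gamma>"
  shows "finite (disagreements \<Gamma> C)" and "disagreements \<Gamma> C \<subseteq> edges \<Gamma>"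
proof -
  show "disagreements \<Gamma> C \<subseteq> edges \<Gamma>"
    using pos_edges_subset neg_edges_subset by (fastforce simp: disagreements_def)
  then show "finite (disagreements \<Gamma> C)"
    using finite_edges[OF assms] finite_subset by blast
qed

text \<open>Agreeing with the positive edges \<open>xy\<close> and \<open>xz\<close> puts \<open>y\<close> and \<open>z\<close> into the same cluster.\<close>

lemma bad_triangle_has_disagreement:
  assumes "signed_graph \<Gamma>" and "clustering \<Gamma> C" and "T \<in> bad_triangles \<Gamma>"
  shows "\<exists>e\<in>disagreements \<Gamma> C. e \<subseteq> T"
proof -
  obtain x y z where T: "T = {x, y, z}" "{x, y} \<in> pos_edges \<Gamma>" "{x, z} \<in> pos_edges \<Gamma>"
      "{y, z} \<in> neg_edges \<Gamma>"
    using assms(3) by (auto simp: bad_triangles_def)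
  then have "x \<in> vertices \<Gamma>" "y \<in> vertices \<Gamma>" "z \<in> vertices \<Gamma>"
    using edge_in_vertices[OF assms(1)] pos_edges_subset by blast+
  then obtain K L M where "K \<in> C" "x \<in> K" "L \<in> C" "y \<in> L" "M \<in> C" "z \<in> M"
    using assms(2) unfolding clustering_def partition_on_def by blast
  note KLM = this
  consider "K \<noteq> L" | "K \<noteq> M" | "L = M" by blast
  then have "{x, y} \<in> disagreements \<Gamma> C \<or> {x, z} \<in> disagreements \<Gamma> C \<or> {y, z} \<in> disagreements \<Gamma> C"
  proof cases
    case 1
    then show ?thesis using T KLM pos_disagreementI by metis
  next
    case 2
    then show ?thesis using T KLM pos_disagreementI by metis
  next
    case 3
    then show ?thesis using T KLM neg_disagreementI by metis
  qed
  then show ?thesis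
    by (elim disjE) (erule rev_bexI, simp add: T(1))+
qed

text \<open>Double counting of the pairs of a disagreement and a bad triangle that contains it.\<close>

lemma bad_triangles_le_twice_disagreements:
  assumes "signed_graph \<Gamma>" and "\<not> contains_a \<Gamma>" and "\<not> contains_c \<Gamma>" and "clustering \<Gamma> C"
  shows "card (bad_triangles \<Gamma>) \<le> 2 * num_disagreements \<Gamma> C"
proof -
  let ?D = "disagreements \<Gamma> C"
  have "bad_triangles \<Gamma> \<subseteq> (\<Union>e\<in>?D. {T \<in> bad_triangles \<Gamma>. e \<subseteq> T})"
    using bad_triangle_has_disagreement[OF assms(1,4)] by blast
  then have "card (bad_triangles \<Gamma>) \<le> card (\<Union>e\<in>?D. {T \<in> bad_triangles \<Gamma>. e \<subseteq> T})"
    using finite_disagreements[OF assms(1)] finite_bad_triangles[OF assms(1)]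
    by (intro card_mono) auto
  also have "\<dots> \<le> (\<Sum>e\<in>?D. card {T \<in> bad_triangles \<Gamma>. e \<subseteq> T})"
    using finite_disagreements(1)[OF assms(1)] by (rule card_UN_le)
  also have "\<dots> \<le> (\<Sum>e\<in>?D. 2)"
    using finite_disagreements(2)[OF assms(1)]
    by (intro sum_mono edge_in_at_most_two_bad_triangles assms) blast
  finally show ?thesis
    by (simp add: num_disagreements_def)
qed


section \<open>Closing a positive path by an edge\<close>

definition triangulated :: "'a sgraph \<Rightarrow> bool" where
  "triangulated \<Gamma> \<longleftrightarrow>
     (\<forall>vs. induced_cycle \<Gamma> vs \<longrightarrow> strongly_positive \<Gamma> vs \<or> weakly_negative \<Gamma> vs \<longrightarrow> length vs = 3)"

definition adj :: "'a set set \<Rightarrow> ('a \<times> 'a) set" where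
  "adj R = {(a, b). {a, b} \<in> R}"

lemma adj_mono: "R \<subseteq> R' \<Longrightarrow> adj R \<subseteq> adj R'"
  by (auto simp: adj_def)

lemma sym_adj_rtrancl: "sym ((adj R)\<^sup>*)"
  by (rule sym_rtrancl) (simp add: adj_def sym_def insert_commute)

lemma relpow_segment:
  assumes "\<And>k. i \<le> k \<Longrightarrow> k < j \<Longrightarrow> (f k, f (Suc k)) \<in> r" and "i \<le> j"
  shows "(f i, f j) \<in> r ^^ (j - i)"
  using assms by (auto simp: relpow_fun_conv intro!: exI[of _ "\<lambda>k. f (i + k)"])

text \<open>Among all edges outside \<open>R\<close> whose ends are joined by an \<open>R\<close>-path, take \<open>ab\<close> with the
  smallest \<open>R\<close>-distance \<open>n\<close> between its ends. A shortest \<open>R\<close>-path from \<open>a\<close> to \<open>b\<close> together with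
  \<open>ab\<close> is an induced cycle: a chord in \<open>R\<close> would shorten the path, and a chord outside \<open>R\<close> would
  join two points at a smaller distance. All edges of this cycle but perhaps \<open>ab\<close> are positive,
  so it is strongly positive or weakly negative, hence a triangle.\<close>

lemma chord_closes_triangle:
  assumes sg: "signed_graph \<Gamma>"
    and short: "triangulated \<Gamma>"
    and R: "R \<subseteq> pos_edges \<Gamma>"
    and uv: "(u, v) \<in> (adj R)\<^sup>*" "{u, v} \<in> edges \<Gamma> - R"
  obtains a w b where "{a, b} \<in> edges \<Gamma> - R" "{a, w} \<in> R" "{w, b} \<in> R"
proof -
  let ?r = "adj R"
  let ?P = "\<lambda>n. \<exists>a b. {a, b} \<in> edges \<Gamma> - R \<and> (a, b) \<in> ?r ^^ n"
  define n where "n = (LEAST n. ?P n)"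
  have "\<exists>n. ?P n" using uv rtrancl_imp_relpow by blast
  then have "?P n" unfolding n_def by (rule LeastI_ex)
  then obtain a b where ab: "{a, b} \<in> edges \<Gamma> - R" "(a, b) \<in> ?r ^^ n" by blast
  have least: "n \<le> m" if "{c, d} \<in> edges \<Gamma> - R" "(c, d) \<in> ?r ^^ m" for c d m
    unfolding n_def using that by (intro Least_le) blast
  obtain f where f: "f 0 = a" "f n = b" "\<And>i. i < n \<Longrightarrow> (f i, f (Suc i)) \<in> ?r"
    using ab(2) by (auto simp: relpow_fun_conv)
  have seg: "(f i, f j) \<in> ?r ^^ (j - i)" if "i \<le> j" "j \<le> n" for i j
    using that f(3) by (intro relpow_segment) auto
  have "n \<noteq> 0" using ab edge_ne[OF sg, of a b] by (cases n) auto
  moreover have "n \<noteq> 1" using ab(1,2) by (auto simp: adj_def)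
  ultimately have n2: "2 \<le> n" by simp

  define vs where "vs = map f [0..<Suc n]"
  have len: "length vs = Suc n" by (simp add: vs_def)
  have nth: "vs ! i = f i" if "i \<le> n" for i
    using that unfolding vs_def by (subst nth_map) (auto simp del: upt_Suc)
  have set_vs: "set vs = f ` {..n}"
    unfolding vs_def by (auto simp del: upt_Suc)
  have ce: "cycle_edges vs = insert {a, b} {{f i, f (Suc i)} | i. i < n}"
  proof -
    have "cycle_edges vs = (\<lambda>i. {vs ! i, vs ! (Suc i mod length vs)}) ` {..<Suc n}"
      by (simp only: cycle_edges_eq_image len)
    also have "{..<Suc n} = insert n {..<n}" by (rule lessThan_Suc)
    also have "(\<lambda>i. {vs ! i, vs ! (Suc i mod length vs)}) ` insert n {..<n} =
        insert {a, b} ((\<lambda>i. {f i, f (Suc i)}) ` {..<n})"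
      using f(1,2) by (auto simp: len nth insert_commute)
    finally show ?thesis by auto
  qed
  have path: "{f i, f (Suc i)} \<in> R" if "i < n" for i
    using f(3)[OF that] by (simp add: adj_def)

  \<comment> \<open>A repeated vertex would allow to cut out a closed part of the path.\<close>
  have ne: "f i \<noteq> f j" if "i < j" "j \<le> n" for i j
  proof
    assume eq: "f i = f j"
    have "(a, f i) \<in> ?r ^^ i" using seg[of 0 i] that f(1) by simp
    moreover have "(f j, b) \<in> ?r ^^ (n - j)" using seg[of j n] that f(2) by simp
    ultimately have "(a, b) \<in> ?r ^^ (i + (n - j))"
      unfolding relpow_add eq by blast
    then show False using least[OF ab(1)] that by fastforce
  qed
  have chordless: "{f i, f j} \<in> cycle_edges vs"
    if ij: "i < j" "j \<le> n" and e: "{f i, f j} \<in> edges \<Gamma>" for i j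
  proof (cases "{f i, f j} \<in> R")
    case True
    have "(a, f i) \<in> ?r ^^ i" using seg[of 0 i] ij f(1) by simp
    moreover have "(f j, b) \<in> ?r ^^ (n - j)" using seg[of j n] ij f(2) by simp
    moreover have "(f i, f j) \<in> ?r ^^ 1" using True by (simp add: adj_def)
    ultimately have "(a, b) \<in> ?r ^^ (i + 1 + (n - j))"
      unfolding relpow_add by blast
    then have "n \<le> i + 1 + (n - j)" using least[OF ab(1)] by blast
    then have "j = Suc i" using ij by simp
    then show ?thesis using ij ce by auto
  next
    case False
    then have "n \<le> j - i"
      using least[of "f i" "f j" "j - i"] seg ij e by simp
    then have "i = 0" "j = n" using ij by auto
    then show ?thesis using ce f by simp
  qed
  have cyc: "cycle \<Gamma> vs"
    unfolding cycle_def
  proof (intro conjI)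
    show "3 \<le> length vs" using n2 len by simp
    show "distinct vs"
      unfolding distinct_conv_nth len
      using nth ne by (metis less_Suc_eq_le linorder_neqE_nat)
    show ce_sub: "cycle_edges vs \<subseteq> edges \<Gamma>"
      using ab(1) path R pos_edges_subset unfolding ce by blast
    show "set vs \<subseteq> vertices \<Gamma>"
    proof
      fix x assume "x \<in> set vs"
      then obtain i where i: "i \<le> n" "x = f i" using set_vs by auto
      show "x \<in> vertices \<Gamma>"
      proof (cases "i = n")
        case True
        then show ?thesis using i f(2) ab(1) edge_in_vertices(2)[OF sg] by blast
      next
        case False
        then have "{f i, f (Suc i)} \<in> edges \<Gamma>"
          using i path R pos_edges_subset by fastforce
        then show ?thesis using i edge_in_vertices(1)[OF sg] by blast
      qed
    qed
  qed
  have "induced_cycle \<Gamma> vs"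
    unfolding induced_cycle_def
  proof (intro conjI cyc ballI impI)
    fix e assume e: "e \<in> edges \<Gamma>" "e \<subseteq> set vs"
    then obtain x y where xy: "e = {x, y}" using edge_doubleton sg by metis
    then obtain i j where ij: "i \<le> n" "j \<le> n" "x = f i" "y = f j"
      using e set_vs by auto
    have "i \<noteq> j" using e xy ij edge_ne[OF sg] by blast
    then consider "i < j" | "j < i" by linarith
    then show "e \<in> cycle_edges vs"
      using chordless[of i j] chordless[of j i] e xy ij by cases (auto simp: insert_commute)
  qed
  moreover have "strongly_positive \<Gamma> vs \<or> weakly_negative \<Gamma> vs"
  proof (cases "{a, b} \<in> pos_edges \<Gamma>")
    case True
    then show ?thesis
      unfolding strongly_positive_def ce using path R by blast
  next
    case False
    then have "{a, b} \<in> neg_edges \<Gamma>" using edge_pos_or_neg[OF sg] ab(1) by blast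
    then have "cycle_edges vs \<inter> neg_edges \<Gamma> = {{a, b}}"
      unfolding ce using path R pos_neg_disjoint by blast
    then show ?thesis by (simp add: weakly_negative_def)
  qed
  ultimately have "length vs = 3" using short unfolding triangulated_def by blast
  then have "n = 2" using len by simp
  then show thesis
    using that[of a b "f 1"] ab path[of 0] path[of 1] f(1,2) by (simp add: numeral_2_eq_2)
qed

section \<open>Coherent clusters\<close>

text \<open>The invariant of the clusters. The connecting paths have to stay within the cluster, so that
  a path that joins two clusters can be built with a prescribed edge as its only crossing.\<close>

definition coherent :: "'a sgraph \<Rightarrow> 'a set \<Rightarrow> bool" where
  "coherent \<Gamma> K \<longleftrightarrow>
     (\<forall>x\<in>K. \<forall>y\<in>K. {x, y} \<notin> neg_edges \<Gamma>) \<and>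
     (\<forall>x\<in>K. \<forall>y\<in>K. (x, y) \<in> (adj {e \<in> pos_edges \<Gamma>. e \<subseteq> K})\<^sup>*)"

lemma coherent_singleton:
  assumes "signed_graph \<Gamma>"
  shows "coherent \<Gamma> {v}"
  using neg_edge_ne[OF assms, of v v] by (auto simp: coherent_def)

lemma coherent_pos_edge:
  assumes "signed_graph \<Gamma>" and "e \<in> pos_edges \<Gamma>"
  shows "coherent \<Gamma> e"
proof -
  obtain a b where e: "e = {a, b}"
    using assms edge_doubleton pos_edges_subset by blast
  let ?r = "adj {f \<in> pos_edges \<Gamma>. f \<subseteq> e}"
  have "(a, b) \<in> ?r" "(b, a) \<in> ?r"
    using assms(2) e by (auto simp: adj_def insert_commute)
  moreover have "{x, y} \<notin> neg_edges \<Gamma>" if "x \<in> e" "y \<in> e" for x y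
    using that assms(2) e pos_neg_disjoint neg_edge_ne[OF assms(1)]
    by (metis doubleton_eq_iff insertE singletonD)
  ultimately show ?thesis
    unfolding coherent_def using e by auto
qed

lemma coherent_Un:
  assumes "coherent \<Gamma> K" and "coherent \<Gamma> L"
    and "\<And>x y. x \<in> K \<Longrightarrow> y \<in> L \<Longrightarrow> {x, y} \<notin> neg_edges \<Gamma>"
    and "x0 \<in> K" and "y0 \<in> L" and "{x0, y0} \<in> pos_edges \<Gamma>"
  shows "coherent \<Gamma> (K \<union> L)"
proof -
  let ?r = "adj {e \<in> pos_edges \<Gamma>. e \<subseteq> K \<union> L}"
  have sym: "sym (?r\<^sup>*)" by (rule sym_adj_rtrancl)
  have K: "(x, x0) \<in> ?r\<^sup>*" if "x \<in> K" for x
    using that assms(1,4) rtrancl_mono[OF adj_mono,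
      of "{e \<in> pos_edges \<Gamma>. e \<subseteq> K}" "{e \<in> pos_edges \<Gamma>. e \<subseteq> K \<union> L}"]
    unfolding coherent_def by blast
  have L: "(y, y0) \<in> ?r\<^sup>*" if "y \<in> L" for y
    using that assms(2,5) rtrancl_mono[OF adj_mono,
      of "{e \<in> pos_edges \<Gamma>. e \<subseteq> L}" "{e \<in> pos_edges \<Gamma>. e \<subseteq> K \<union> L}"]
    unfolding coherent_def by blast
  have "(x0, y0) \<in> ?r" using assms(4-6) by (simp add: adj_def)
  then have all: "(x, x0) \<in> ?r\<^sup>*" if "x \<in> K \<union> L" for x
    using that K L sym by (meson UnE r_into_rtrancl rtrancl_trans symD)
  have "(x, y) \<in> ?r\<^sup>*" if "x \<in> K \<union> L" "y \<in> K \<union> L" for x y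
    using all[OF that(1)] all[OF that(2)] sym by (meson rtrancl_trans symD)
  moreover have "{x, y} \<notin> neg_edges \<Gamma>" if "x \<in> K \<union> L" "y \<in> K \<union> L" for x y
    using that assms(1-3) unfolding coherent_def by (metis UnE insert_commute)
  ultimately show ?thesis unfolding coherent_def by blast
qed

text \<open>Let \<open>H\<close> be the set of edges of strongly positive triangles. If some edge outside \<open>H\<close> joined
  two vertices of one \<open>H\<close>-component, then some edge \<open>ab\<close> outside \<open>H\<close> would close a path
  \<open>a, w, b\<close> of two edges of \<open>H\<close>. It is not positive, as \<open>abw\<close> would be a strongly positive
  triangle. If it is negative, take strongly positive triangles \<open>awz\<close> and \<open>bwz'\<close>: with
  \<open>z = z'\<close> they give the graph (a) (the vertices \<open>w\<close> and \<open>z\<close> both see \<open>a\<close> and \<open>b\<close>), otherwise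
  the graph (b).\<close>

lemma triangle_connected_pos:
  assumes sg: "signed_graph \<Gamma>"
    and short: "triangulated \<Gamma>"
    and no_a: "\<not> contains_a \<Gamma>" and no_b: "\<not> contains_b \<Gamma>"
    and H: "H = {e \<in> pos_edges \<Gamma>. \<exists>S\<in>pos_triangles \<Gamma>. e \<subseteq> S}"
    and uv: "(u, v) \<in> (adj H)\<^sup>*" "{u, v} \<in> edges \<Gamma>"
  shows "{u, v} \<in> H"
proof (rule ccontr)
  assume "{u, v} \<notin> H"
  then have uv': "{u, v} \<in> edges \<Gamma> - H" using uv(2) by simp
  have "H \<subseteq> pos_edges \<Gamma>" using H by auto
  then obtain a w b where awb: "{a, b} \<in> edges \<Gamma> - H" "{a, w} \<in> H" "{w, b} \<in> H"
    using chord_closes_triangle[OF sg short _ uv(1) uv'] by metis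
  have third: "\<exists>z. {x, z} \<in> pos_edges \<Gamma> \<and> {y, z} \<in> pos_edges \<Gamma>" if xy: "{x, y} \<in> H" for x y
  proof -
    obtain S where S: "S \<in> pos_triangles \<Gamma>" "{x, y} \<subseteq> S" using xy H by auto
    then obtain p q s where pqs: "S = {p, q, s}" "p \<noteq> q" "p \<noteq> s" "q \<noteq> s"
      using pos_edge_ne[OF sg] by (auto simp: pos_triangles_eq[OF sg])
    then have "card S = 3" by simp
    then have "\<not> S \<subseteq> {x, y}"
      using card_mono[of "{x, y}" S] card_insert_le_m1[of 2 "{y}" x] by auto
    then obtain z where "z \<in> S" "z \<noteq> x" "z \<noteq> y" by auto
    then show ?thesis
      using pos_triangle_pair[OF sg S(1), of x z] pos_triangle_pair[OF sg S(1), of y z] S(2) by auto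
  qed
  have pos: "{a, w} \<in> pos_edges \<Gamma>" "{b, w} \<in> pos_edges \<Gamma>"
    using awb H by (auto simp: insert_commute)
  have neg: "{a, b} \<in> neg_edges \<Gamma>"
  proof (rule ccontr)
    assume "{a, b} \<notin> neg_edges \<Gamma>"
    then have p: "{a, b} \<in> pos_edges \<Gamma>" using edge_pos_or_neg[OF sg] awb by blast
    then have "{a, b, w} \<in> pos_triangles \<Gamma>"
      using pos unfolding pos_triangles_eq[OF sg] by blast
    then show False using p awb(1) H by blast
  qed
  obtain z where z: "{a, z} \<in> pos_edges \<Gamma>" "{w, z} \<in> pos_edges \<Gamma>" using third awb(2) by blast
  obtain z' where z': "{b, z'} \<in> pos_edges \<Gamma>" "{w, z'} \<in> pos_edges \<Gamma>" using third awb(3) by blast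
  have "z \<noteq> b" using z neg pos_neg_disjoint by metis
  moreover have "z' \<noteq> a" using z' neg pos_neg_disjoint by (metis insert_commute)
  ultimately have d: "distinct [a, b, w, z]" "distinct [a, b, w, z']"
    using pos_edge_ne[OF sg] neg_edge_ne[OF sg] neg pos z z' by auto
  show False
  proof (cases "z = z'")
    case True
    have "contains_a \<Gamma>"
      unfolding contains_a_def using d(1) neg pos z z' True
      by (intro exI[of _ a] exI[of _ b] exI[of _ w] exI[of _ z]) auto
    then show False using no_a by simp
  next
    case False
    have "contains_b \<Gamma>"
      unfolding contains_b_def using d neg pos z z' False
      by (intro exI[of _ a] exI[of _ b] exI[of _ w] exI[of _ z] exI[of _ z']) auto
    then show False using no_b by simp
  qed
qed

text \<open>The triangles that supply the edges of the path are kept inside \<open>K\<close>, which makes the path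
  usable both in the set of all edges of strongly positive triangles and in the set of positive
  edges within \<open>K\<close>.\<close>

lemma step2_cluster_connected:
  assumes sg: "signed_graph \<Gamma>" and K: "K \<in> step2_clusters \<Gamma>" and xy: "x \<in> K" "y \<in> K"
  shows "(x, y) \<in> (adj {e \<in> pos_edges \<Gamma>. \<exists>S\<in>pos_triangles \<Gamma>. e \<subseteq> S \<and> S \<subseteq> K})\<^sup>*"
    (is "_ \<in> (adj ?R)\<^sup>*")
proof -
  let ?t = "touching (pos_triangles \<Gamma>)"
  obtain T where T: "T \<in> pos_triangles \<Gamma>" "K = \<Union> (?t\<^sup>+ `` {T})"
    using K by (auto simp: step2_clusters_def)
  have ne: "S \<noteq> {}" if "S \<in> pos_triangles \<Gamma>" for S
    using that unfolding pos_triangles_eq[OF sg] by blast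
  have "(T, T) \<in> ?t" using T ne by (auto simp: touching_def)
  then have TK: "T \<subseteq> K" using T by blast
  have in_triangle: "(p, q) \<in> (adj ?R)\<^sup>*"
    if "S \<in> pos_triangles \<Gamma>" "S \<subseteq> K" "p \<in> S" "q \<in> S" for S p q
    using that pos_triangle_pair[OF sg, of S p q]
    by (cases "p = q") (auto simp: adj_def)
  obtain t where t: "t \<in> T" using ne T(1) by blast
  have "\<forall>q\<in>S. (t, q) \<in> (adj ?R)\<^sup>*" if "(T, S) \<in> ?t\<^sup>+" for S
    using that
  proof (induction rule: trancl_induct)
    case (base S)
    then have S: "S \<in> pos_triangles \<Gamma>" "S \<subseteq> K" "S \<inter> T \<noteq> {}"
      using T(2) by (auto simp: touching_def)
    then show ?case
      using in_triangle[OF T(1) TK t] in_triangle[of S] by (blast intro: rtrancl_trans)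
  next
    case (step S S')
    then have "(T, S') \<in> ?t\<^sup>+" by simp
    then have "S' \<in> pos_triangles \<Gamma>" "S' \<subseteq> K" "S \<inter> S' \<noteq> {}"
      using step(2) T(2) by (auto simp: touching_def)
    then show ?case
      using step.IH in_triangle[of S'] by (blast intro: rtrancl_trans)
  qed
  then have "(t, q) \<in> (adj ?R)\<^sup>*" if "q \<in> K" for q
    using that T(2) by blast
  then show ?thesis
    using xy sym_adj_rtrancl[of ?R] by (meson rtrancl_trans symD)
qed

lemma coherent_step2_cluster:
  assumes sg: "signed_graph \<Gamma>"
    and short: "triangulated \<Gamma>"
    and no_a: "\<not> contains_a \<Gamma>" and no_b: "\<not> contains_b \<Gamma>"
    and K: "K \<in> step2_clusters \<Gamma>"
  shows "coherent \<Gamma> K"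
proof -
  let ?R = "{e \<in> pos_edges \<Gamma>. \<exists>S\<in>pos_triangles \<Gamma>. e \<subseteq> S \<and> S \<subseteq> K}"
  let ?H = "{e \<in> pos_edges \<Gamma>. \<exists>S\<in>pos_triangles \<Gamma>. e \<subseteq> S}"
  have "{x, y} \<notin> neg_edges \<Gamma>" if "x \<in> K" "y \<in> K" for x y
  proof
    assume n: "{x, y} \<in> neg_edges \<Gamma>"
    have "(x, y) \<in> (adj ?R)\<^sup>*"
      using step2_cluster_connected[OF sg K that] .
    moreover have "adj ?R \<subseteq> adj ?H" by (rule adj_mono) blast
    ultimately have "(x, y) \<in> (adj ?H)\<^sup>*" using rtrancl_mono by blast
    then have "{x, y} \<in> ?H"
      using triangle_connected_pos[OF sg short no_a no_b refl] n neg_edges_subset by blast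
    then show False using n pos_neg_disjoint by blast
  qed
  moreover have "(x, y) \<in> (adj {e \<in> pos_edges \<Gamma>. e \<subseteq> K})\<^sup>*" if "x \<in> K" "y \<in> K" for x y
  proof -
    have "adj ?R \<subseteq> adj {e \<in> pos_edges \<Gamma>. e \<subseteq> K}" by (rule adj_mono) blast
    then show ?thesis
      using step2_cluster_connected[OF sg K that] rtrancl_mono by blast
  qed
  ultimately show ?thesis unfolding coherent_def by blast
qed

section \<open>The clusters of the algorithm\<close>

lemma pos_degree_ge_1_iff:
  assumes "signed_graph \<Gamma>"
  shows "pos_degree \<Gamma> K L \<ge> 1 \<longleftrightarrow> (\<exists>x\<in>K. \<exists>y\<in>L. {x, y} \<in> pos_edges \<Gamma>)"
proof -
  let ?S = "{{x, y} | x y. x \<in> K \<and> y \<in> L \<and> {x, y} \<in> pos_edges \<Gamma>}"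
  have "?S \<subseteq> edges \<Gamma>" using pos_edges_subset by blast
  then have "finite ?S" using finite_edges[OF assms] finite_subset by blast
  then have "pos_degree \<Gamma> K L \<ge> 1 \<longleftrightarrow> ?S \<noteq> {}"
    unfolding pos_degree_def by (simp add: Suc_le_eq card_gt_0_iff)
  then show ?thesis by blast
qed

lemma neg_degree_0_iff:
  assumes "signed_graph \<Gamma>"
  shows "neg_degree \<Gamma> K L = 0 \<longleftrightarrow> (\<forall>x\<in>K. \<forall>y\<in>L. {x, y} \<notin> neg_edges \<Gamma>)"
proof -
  let ?S = "{{x, y} | x y. x \<in> K \<and> y \<in> L \<and> {x, y} \<in> neg_edges \<Gamma>}"
  have "?S \<subseteq> edges \<Gamma>" using neg_edges_subset by blast
  then have "finite ?S" using finite_edges[OF assms] finite_subset by blast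
  then have "neg_degree \<Gamma> K L = 0 \<longleftrightarrow> ?S = {}"
    unfolding neg_degree_def by simp
  then show ?thesis by blast
qed

text \<open>Besides coherence, it is kept that every strongly positive triangle lies in one cluster, so
  that the triangles found between different clusters are bad.\<close>

lemma merge_step_coherent:
  assumes "signed_graph \<Gamma>" and "merge_step \<Gamma> C C'"
    and "\<forall>K\<in>C. coherent \<Gamma> K" and "\<forall>S\<in>pos_triangles \<Gamma>. \<exists>K\<in>C. S \<subseteq> K"
  shows "\<forall>K\<in>C'. coherent \<Gamma> K" and "\<forall>S\<in>pos_triangles \<Gamma>. \<exists>K\<in>C'. S \<subseteq> K"
proof -
  obtain K L where KL: "mergeable \<Gamma> C K L" "C' = insert (K \<union> L) (C - {K, L})"
    using assms(2) by (auto simp: merge_step_def)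
  then have "K \<in> C" "L \<in> C" "\<forall>x\<in>K. \<forall>y\<in>L. {x, y} \<notin> neg_edges \<Gamma>"
      "\<exists>x\<in>K. \<exists>y\<in>L. {x, y} \<in> pos_edges \<Gamma>"
    using pos_degree_ge_1_iff[OF assms(1)] neg_degree_0_iff[OF assms(1)]
    unfolding mergeable_def by blast+
  then have "coherent \<Gamma> (K \<union> L)"
    using assms(3) coherent_Un[of \<Gamma> K L] by blast
  then show "\<forall>K\<in>C'. coherent \<Gamma> K" using assms(3) KL(2) by blast
  show "\<forall>S\<in>pos_triangles \<Gamma>. \<exists>K\<in>C'. S \<subseteq> K"
  proof
    fix S assume "S \<in> pos_triangles \<Gamma>"
    then obtain J where J: "J \<in> C" "S \<subseteq> J" using assms(4) by auto
    show "\<exists>K\<in>C'. S \<subseteq> K"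
    proof (cases "J = K \<or> J = L")
      case True
      then have "S \<subseteq> K \<union> L" using J(2) by auto
      then show ?thesis using KL(2) by auto
    next
      case False
      then show ?thesis using J KL(2) by auto
    qed
  qed
qed

lemma merge_steps_coherent:
  assumes "signed_graph \<Gamma>" and "(merge_step \<Gamma>)\<^sup>*\<^sup>* C C'"
    and "\<forall>K\<in>C. coherent \<Gamma> K" and "\<forall>S\<in>pos_triangles \<Gamma>. \<exists>K\<in>C. S \<subseteq> K"
  shows "(\<forall>K\<in>C'. coherent \<Gamma> K) \<and> (\<forall>S\<in>pos_triangles \<Gamma>. \<exists>K\<in>C'. S \<subseteq> K)"
  using assms(2)
proof (induction rule: rtranclp_induct)
  case base
  then show ?case using assms(3,4) by simp
next
  case (step C1 C2)
  then show ?case using merge_step_coherent[OF assms(1) step.hyps(2)] by simp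
qed

lemma remove_vertices_signed_graph:
  assumes "signed_graph \<Gamma>"
  shows "signed_graph (remove_vertices \<Gamma> S)"
  using assms by (auto simp: signed_graph_def remove_vertices_def)

lemma pos_edge_avoids_step1_vertices:
  assumes "e \<in> pos_edges \<Gamma>"
  shows "e \<inter> step1_vertices \<Gamma> = {}"
  using assms pos_neg_disjoint pos_edges_subset by (fastforce simp: step1_vertices_def)

lemma pos_triangles_remove_step1:
  assumes "signed_graph \<Gamma>"
  shows "pos_triangles (remove_vertices \<Gamma> (step1_vertices \<Gamma>)) = pos_triangles \<Gamma>"
proof -
  have "pos_edges (remove_vertices \<Gamma> (step1_vertices \<Gamma>)) = pos_edges \<Gamma>"
    using pos_edge_avoids_step1_vertices
    by (fastforce simp: pos_edges_def remove_vertices_def)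
  then show ?thesis
    by (simp add: pos_triangles_eq assms remove_vertices_signed_graph)
qed

text \<open>The vertices removed in step (1) lie on no positive edge, so step (2) finds the same triangles
  as in \<open>\<Gamma>\<close>. Its clusters, the matching edges and the single vertices are coherent, and merging
  preserves this.\<close>

lemma cc_output_structure:
  assumes sg: "signed_graph \<Gamma>"
    and short: "triangulated \<Gamma>"
    and no_a: "\<not> contains_a \<Gamma>" and no_b: "\<not> contains_b \<Gamma>"
    and out: "cc_output \<Gamma> Sol"
  obtains C where "Sol = singletons (step1_vertices \<Gamma>) \<union> C"
    "\<forall>K\<in>C. coherent \<Gamma> K" "\<forall>S\<in>pos_triangles \<Gamma>. \<exists>K\<in>C. S \<subseteq> K" "\<nexists>K L. mergeable \<Gamma> C K L"
proof -
  obtain \<Gamma>1 T \<Gamma>2 M C0 C where *: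
    "\<Gamma>1 = remove_vertices \<Gamma> (step1_vertices \<Gamma>)" "T = step2_clusters \<Gamma>1"
    "\<Gamma>2 = remove_vertices \<Gamma>1 (\<Union>T)" "max_pos_matching \<Gamma>2 M"
    "C0 = T \<union> M \<union> singletons (vertices \<Gamma>2 - \<Union>M)" "(merge_step \<Gamma>)\<^sup>*\<^sup>* C0 C"
    "\<nexists>K L. mergeable \<Gamma> C K L" "Sol = singletons (step1_vertices \<Gamma>) \<union> C"
    using out unfolding cc_output_def by blast
  have T: "T = step2_clusters \<Gamma>"
    using * pos_triangles_remove_step1[OF sg] by (simp add: step2_clusters_def)
  have "M \<subseteq> pos_edges \<Gamma>2"
    using *(4) by (simp add: max_pos_matching_def pos_matching_def)
  also have "\<dots> \<subseteq> pos_edges \<Gamma>"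
    unfolding *(1,3) by (auto simp: pos_edges_def remove_vertices_def)
  finally have "\<forall>K\<in>C0. coherent \<Gamma> K"
    using coherent_step2_cluster[OF sg short no_a no_b] coherent_pos_edge[OF sg]
      coherent_singleton[OF sg] unfolding *(5) T singletons_def by blast
  moreover have "\<forall>S\<in>pos_triangles \<Gamma>. \<exists>K\<in>C0. S \<subseteq> K"
  proof
    fix S assume S: "S \<in> pos_triangles \<Gamma>"
    then have "S \<noteq> {}" unfolding pos_triangles_eq[OF sg] by blast
    then have "(S, S) \<in> (touching (pos_triangles \<Gamma>))\<^sup>+"
      using S by (auto simp: touching_def)
    then show "\<exists>K\<in>C0. S \<subseteq> K"
      using S unfolding *(5) T step2_clusters_def by blast
  qed
  ultimately show thesis
    using that[of C] merge_steps_coherent[OF sg *(6)] *(7,8) by blast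
qed

section \<open>Charging cut edges to weakly negative triangles\<close>

text \<open>Let \<open>R\<close> consist of \<open>xy\<close> and of the positive edges inside \<open>K\<close> or inside \<open>L\<close>. It connects
  \<open>K \<union> L\<close>, and the negative edge \<open>x'y'\<close> is outside \<open>R\<close>, so some edge \<open>ab\<close> outside \<open>R\<close> closes a
  path \<open>a, w, b\<close> in \<open>R\<close>. All edges inside \<open>K\<close> or inside \<open>L\<close> belong to \<open>R\<close>, so \<open>ab\<close> goes between
  \<open>K\<close> and \<open>L\<close>, and so does one edge of the path, which must be \<open>xy\<close>. Finally \<open>ab\<close> is negative, as
  no strongly positive triangle meets both clusters.\<close>

lemma cut_edge_in_bad_triangle:
  assumes sg: "signed_graph \<Gamma>"
    and short: "triangulated \<Gamma>"
    and K: "coherent \<Gamma> K" and L: "coherent \<Gamma> L" and KL: "K \<inter> L = {}"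
    and no_tri: "\<And>S. S \<in> pos_triangles \<Gamma> \<Longrightarrow> S \<inter> K = {} \<or> S \<inter> L = {}"
    and xy: "x \<in> K" "y \<in> L" "{x, y} \<in> pos_edges \<Gamma>"
    and neg: "x' \<in> K" "y' \<in> L" "{x', y'} \<in> neg_edges \<Gamma>"
  shows "\<exists>z. z \<in> K \<and> {x, z} \<in> pos_edges \<Gamma> \<and> {y, z} \<in> neg_edges \<Gamma> \<or>
             z \<in> L \<and> {y, z} \<in> pos_edges \<Gamma> \<and> {x, z} \<in> neg_edges \<Gamma>"
proof -
  let ?K = "{e \<in> pos_edges \<Gamma>. e \<subseteq> K}" and ?L = "{e \<in> pos_edges \<Gamma>. e \<subseteq> L}"
  let ?R = "insert {x, y} (?K \<union> ?L)"
  have R: "?R \<subseteq> pos_edges \<Gamma>" using xy(3) by blast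
  have "adj ?K \<subseteq> adj ?R" "adj ?L \<subseteq> adj ?R" by (rule adj_mono; blast)+
  then have mono: "(adj ?K)\<^sup>* \<subseteq> (adj ?R)\<^sup>*" "(adj ?L)\<^sup>* \<subseteq> (adj ?R)\<^sup>*"
    by (auto intro: rtrancl_mono[THEN subsetD])
  have "(x', x) \<in> (adj ?R)\<^sup>*" using K neg(1) xy(1) mono(1) unfolding coherent_def by blast
  also have "(x, y) \<in> adj ?R" by (simp add: adj_def)
  also have "(y, y') \<in> (adj ?R)\<^sup>*" using L neg(2) xy(2) mono(2) unfolding coherent_def by blast
  finally have conn: "(x', y') \<in> (adj ?R)\<^sup>*" .
  have "{x', y'} \<notin> ?R"
  proof
    assume "{x', y'} \<in> ?R"
    then have "{x', y'} \<in> pos_edges \<Gamma>" by (rule subsetD[OF R])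
    then show False using pos_neg_disjoint neg(3) by metis
  qed
  then have "{x', y'} \<in> edges \<Gamma> - ?R"
    using subsetD[OF neg_edges_subset neg(3)] by (rule DiffI[rotated])
  then obtain a w b where awb: "{a, b} \<in> edges \<Gamma> - ?R"
      "{a, w} \<in> ?R" "{w, b} \<in> ?R"
    by (rule chord_closes_triangle[OF sg short R conn])
  have in_KL: "e \<subseteq> K \<union> L" if "e \<in> ?R" for e using that xy by auto
  then have abw: "a \<in> K \<union> L" "b \<in> K \<union> L" "w \<in> K \<union> L" using awb(2,3) by blast+
  have inside: "{p, q} \<in> ?R" if "{p, q} \<in> edges \<Gamma>" "p \<in> J" "q \<in> J" "J = K \<or> J = L" for p q J
    using that K L edge_pos_or_neg[OF sg that(1)] unfolding coherent_def by blast
  \<comment> \<open>The ends of \<open>ab\<close> may lie on either side, hence the statement for a general pair.\<close>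
  have cross: "\<exists>z. z \<in> K \<and> {x, z} \<in> pos_edges \<Gamma> \<and> {y, z} \<in> neg_edges \<Gamma> \<or>
             z \<in> L \<and> {y, z} \<in> pos_edges \<Gamma> \<and> {x, z} \<in> neg_edges \<Gamma>"
    if p: "p \<in> K" "q \<in> L" "{p, q} \<in> edges \<Gamma> - ?R" "{p, w} \<in> ?R" "{w, q} \<in> ?R" for p q
  proof -
    have pos: "{p, w} \<in> pos_edges \<Gamma>" "{w, q} \<in> pos_edges \<Gamma>" using p R by blast+
    have neg: "{p, q} \<in> neg_edges \<Gamma>"
    proof (rule ccontr)
      assume "{p, q} \<notin> neg_edges \<Gamma>"
      then have "{p, q} \<in> pos_edges \<Gamma>" using p edge_pos_or_neg[OF sg] by blast
      then have "{p, w, q} \<in> pos_triangles \<Gamma>"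
        using pos unfolding pos_triangles_eq[OF sg] by blast
      then show False using no_tri p by blast
    qed
    show ?thesis
    proof (cases "w \<in> K")
      case True
      then have "{w, q} = {x, y}" using p KL by blast
      then have "w = x" "q = y" using True p(2) xy KL by (auto simp: doubleton_eq_iff)
      then show ?thesis using pos neg p by (auto simp: insert_commute)
    next
      case False
      then have "{p, w} = {x, y}" "w \<in> L" using p KL abw by blast+
      then have "p = x" "w = y" using p(1) xy KL by (auto simp: doubleton_eq_iff)
      then show ?thesis using pos neg p by (auto simp: insert_commute)
    qed
  qed
  have "a \<in> K \<and> b \<in> L \<or> a \<in> L \<and> b \<in> K"
    using abw awb(1) inside by blast
  then show ?thesis
    using cross[of a b] cross[of b a] awb by (auto simp: insert_commute)
qed

text \<open>The triangle \<open>T\<close> pays for the cut edge \<open>e\<close>. Requiring its other positive edge to lie within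
  a cluster is what makes \<open>e\<close> recoverable from \<open>T\<close>.\<close>

definition charges :: "'a sgraph \<Rightarrow> 'a set set \<Rightarrow> 'a set \<Rightarrow> 'a set \<Rightarrow> bool" where
  "charges \<Gamma> C e T \<longleftrightarrow> (\<exists>x y z K. e = {x, y} \<and> T = {x, y, z} \<and> K \<in> C \<and> x \<in> K \<and> z \<in> K \<and>
     {x, y} \<in> pos_edges \<Gamma> \<and> {x, z} \<in> pos_edges \<Gamma> \<and> {y, z} \<in> neg_edges \<Gamma>)"

lemma chargesI:
  assumes "{x, y} \<in> pos_edges \<Gamma>" "{x, z} \<in> pos_edges \<Gamma>" "{y, z} \<in> neg_edges \<Gamma>"
    and "K \<in> C" "x \<in> K" "z \<in> K"
  shows "charges \<Gamma> C {x, y} {x, y, z}"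
  unfolding charges_def using assms
  by (intro exI[of _ x] exI[of _ y] exI[of _ z] exI[of _ K]) simp

lemma charges_bad_triangle: "charges \<Gamma> C e T \<Longrightarrow> T \<in> bad_triangles \<Gamma>"
  unfolding charges_def bad_triangles_def by auto

lemma charges_inj:
  assumes sg: "signed_graph \<Gamma>"
    and ch: "charges \<Gamma> C e T" "charges \<Gamma> C e' T"
    and cut: "\<And>K. K \<in> C \<Longrightarrow> \<not> e' \<subseteq> K"
  shows "e = e'"
proof -
  obtain x y z K where e: "e = {x, y}" "T = {x, y, z}" "K \<in> C" "x \<in> K" "z \<in> K"
      "{y, z} \<in> neg_edges \<Gamma>"
    using ch(1) unfolding charges_def by blast
  obtain p q where e': "e' = {p, q}" "{p, q} \<in> pos_edges \<Gamma>" "{p, q} \<subseteq> T"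
    using ch(2) unfolding charges_def by blast
  have "p \<noteq> q" using e'(2) pos_edge_ne[OF sg] by blast
  then have "e' = {x, y} \<or> e' = {x, z} \<or> e' = {y, z}"
    using e' e(2) by auto
  moreover have "e' \<noteq> {y, z}" using e' e(6) pos_neg_disjoint by metis
  moreover have "e' \<noteq> {x, z}" using cut[OF e(3)] e(4,5) by blast
  ultimately show ?thesis using e(1) by blast
qed

text \<open>A disagreement is a positive edge between two clusters of the merging phase. The negative
  edge required by \<open>cut_edge_in_bad_triangle\<close> exists because these clusters are not
  mergeable.\<close>

lemma cc_disagreement_charges:
  assumes sg: "signed_graph \<Gamma>"
    and short: "triangulated \<Gamma>"
    and no_a: "\<not> contains_a \<Gamma>" and no_b: "\<not> contains_b \<Gamma>"
    and out: "cc_output \<Gamma> Sol" and e: "e \<in> disagreements \<Gamma> Sol"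
  shows "(\<exists>T. charges \<Gamma> Sol e T) \<and> (\<forall>K\<in>Sol. \<not> e \<subseteq> K)"
proof -
  obtain C where C: "Sol = singletons (step1_vertices \<Gamma>) \<union> C"
    "\<forall>K\<in>C. coherent \<Gamma> K" "\<forall>S\<in>pos_triangles \<Gamma>. \<exists>K\<in>C. S \<subseteq> K" "\<nexists>K L. mergeable \<Gamma> C K L"
    using cc_output_structure[OF sg short no_a no_b out] by metis
  have disj: "K \<inter> L = {}" if "K \<in> Sol" "L \<in> Sol" "K \<noteq> L" for K L
    using cc_output_clustering[OF sg out] that
    by (auto simp: clustering_def partition_on_def pairwise_def disjnt_def)
  have "\<forall>K\<in>Sol. coherent \<Gamma> K"
    using C(1,2) coherent_singleton[OF sg] unfolding singletons_def by blast
  then obtain x y K L where xy: "e = {x, y}" "{x, y} \<in> pos_edges \<Gamma>" "K \<in> Sol" "L \<in> Sol" "K \<noteq> L"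
      "x \<in> K" "y \<in> L"
    using e unfolding disagreements_def coherent_def by blast
  have cut: "\<forall>J\<in>Sol. \<not> e \<subseteq> J"
  proof (intro ballI notI)
    fix J assume J: "J \<in> Sol" "e \<subseteq> J"
    then have "x \<in> J" "y \<in> J" using xy(1) by auto
    then have "J = K" "J = L" using disj[OF J(1)] xy(3-7) by auto
    then show False using xy(5) by simp
  qed
  have KLC: "K \<in> C" "L \<in> C"
    using xy C(1) pos_edge_avoids_step1_vertices[OF xy(2)] unfolding singletons_def by blast+
  have coh: "coherent \<Gamma> K" "coherent \<Gamma> L" using C(2) KLC by blast+
  have no_tri: "S \<inter> K = {} \<or> S \<inter> L = {}" if S: "S \<in> pos_triangles \<Gamma>" for S
  proof -
    obtain J where "J \<in> Sol" "S \<subseteq> J" using C(1,3) S by blast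
    then show ?thesis using disj[of J K] disj[of J L] xy(3-5) by blast
  qed
  have "pos_degree \<Gamma> K L \<ge> 1" using pos_degree_ge_1_iff[OF sg] xy by blast
  then have "neg_degree \<Gamma> K L \<noteq> 0"
    using C(4) KLC xy(5) mergeable_def by metis
  then obtain x' y' where neg: "x' \<in> K" "y' \<in> L" "{x', y'} \<in> neg_edges \<Gamma>"
    using neg_degree_0_iff[OF sg, of K L] by auto
  have "\<exists>z. z \<in> K \<and> {x, z} \<in> pos_edges \<Gamma> \<and> {y, z} \<in> neg_edges \<Gamma> \<or>
             z \<in> L \<and> {y, z} \<in> pos_edges \<Gamma> \<and> {x, z} \<in> neg_edges \<Gamma>"
    by (rule cut_edge_in_bad_triangle[OF sg short coh disj[OF xy(3-5)] no_tri xy(6,7,2) neg])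
  then obtain z where "z \<in> K \<and> {x, z} \<in> pos_edges \<Gamma> \<and> {y, z} \<in> neg_edges \<Gamma> \<or>
             z \<in> L \<and> {y, z} \<in> pos_edges \<Gamma> \<and> {x, z} \<in> neg_edges \<Gamma>" ..
  then have "charges \<Gamma> Sol e {x, y, z}"
  proof
    assume "z \<in> K \<and> {x, z} \<in> pos_edges \<Gamma> \<and> {y, z} \<in> neg_edges \<Gamma>"
    then show ?thesis
      unfolding xy(1) using chargesI[of x y \<Gamma> z K Sol] xy by simp
  next
    assume "z \<in> L \<and> {y, z} \<in> pos_edges \<Gamma> \<and> {x, z} \<in> neg_edges \<Gamma>"
    then show ?thesis
      unfolding xy(1) using chargesI[of y x \<Gamma> z L Sol] xy by (simp add: insert_commute)
  qed
  then show ?thesis using cut by auto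
qed

lemma cc_disagreements_le_bad_triangles:
  assumes sg: "signed_graph \<Gamma>"
    and short: "triangulated \<Gamma>"
    and no_a: "\<not> contains_a \<Gamma>" and no_b: "\<not> contains_b \<Gamma>"
    and out: "cc_output \<Gamma> Sol"
  shows "num_disagreements \<Gamma> Sol \<le> card (bad_triangles \<Gamma>)"
proof -
  note ch = cc_disagreement_charges[OF sg short no_a no_b out]
  then obtain t where t: "\<And>e. e \<in> disagreements \<Gamma> Sol \<Longrightarrow> charges \<Gamma> Sol e (t e)"
    by metis
  have "inj_on t (disagreements \<Gamma> Sol)"
  proof (rule inj_onI)
    fix e e' assume e: "e \<in> disagreements \<Gamma> Sol" "e' \<in> disagreements \<Gamma> Sol" "t e = t e'"
    show "e = e'"
      using charges_inj[OF sg, of Sol e "t e" e'] t[OF e(1)] t[OF e(2)] e(3) ch[OF e(2)] by simp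
  qed
  moreover have "t ` disagreements \<Gamma> Sol \<subseteq> bad_triangles \<Gamma>"
    using t charges_bad_triangle by blast
  ultimately show ?thesis
    unfolding num_disagreements_def using finite_bad_triangles[OF sg] by (rule card_inj_on_le)
qed

theorem theorem2p9:
  fixes \<Gamma> :: "'a sgraph" and Sol :: "'a set set"
  assumes "signed_graph \<Gamma>"
    and "\<And>vs. induced_cycle \<Gamma> vs \<Longrightarrow> strongly_positive \<Gamma> vs \<Longrightarrow> length vs = 3"
    and "\<And>vs. induced_cycle \<Gamma> vs \<Longrightarrow> weakly_negative \<Gamma> vs \<Longrightarrow> length vs = 3"
    and "\<not> contains_a \<Gamma>" and "\<not> contains_b \<Gamma>" and "\<not> contains_c \<Gamma>"
    and "cc_output \<Gamma> Sol"
  shows "num_disagreements \<Gamma> Sol \<le> 2 * opt_disagreements \<Gamma>"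
proof -
  obtain C where C: "clustering \<Gamma> C" "num_disagreements \<Gamma> C = opt_disagreements \<Gamma>"
    using opt_disagreements_attained[OF assms(1)] by blast
  have "num_disagreements \<Gamma> Sol \<le> card (bad_triangles \<Gamma>)"
    using assms by (intro cc_disagreements_le_bad_triangles) (auto simp: triangulated_def)
  also have "\<dots> \<le> 2 * opt_disagreements \<Gamma>"
    using bad_triangles_le_twice_disagreements[OF assms(1,4,6) C(1)] C(2) by simp
  finally show ?thesis .
qed

end
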